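(* Let $p\geq 1$ and let $S^p$ be the $p$-sun, of order $n=2p+1$. Then $$RE(S^p)=E_{\mathcal{L}}(S^p)=2(p-1)\frac{\sqrt{2}}{2}+2=(n-3)\frac{\sqrt{2}}{2}+2.$$
   Context: Graphs are finite, simple and undirected. For a graph $G$ with vertex set $V$, edge set $E$ and vertex degrees $d_u$, the Randić matrix $R=[r_{uv}]$ is the real symmetric matrix indexed by $V$ with $r_{uv}=1/\sqrt{d_ud_v}$ if $uv\in E$ and $r_{uv}=0$ otherwise. The Randić energy is $RE(G)=\sum_{i=1}^n|\lambda_i|$, where $\lambda_1,\dots,\lambda_n$ are the eigenvalues of $R$ with multiplicity. For a graph without isolated vertices, the normalized Laplacian is $\mathcal{L}=I_n-R$, with eigenvalues $\mu_1,\dots,\mu_n$, and the normalized Laplacian energy is $E_{\mathcal{L}}(G)=\sum_{i=1}^n|\mu_i-1|$. The $p$-sun $S^p$ is the tree of order $2p+1$ obtained from the star on $p+1$ vertices (one center joined to $p$ leaves) by subdividing each edge once. *)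

theory Defs
  imports
    Complex_Main
    "Jordan_Normal_Form.Char_Poly"
    "Graph_Theory.Pair_Digraph"
    "Graph_Theory.Digraph_Isomorphism"
begin

text \<open>
  A finite simple undirected graph is a \<^locale>\<open>pair_graph\<close>: an edge \<open>uv\<close> is the pair of opposite
  arcs \<open>(u,v)\<close>, \<open>(v,u)\<close>, so that the degree of a vertex is its \<^const>\<open>out_degree\<close>.
  Matrices are indexed by \<open>{0..<n}\<close>; a matrix indexed by the vertices of \<open>G\<close> is therefore taken with
  respect to an explicit enumeration \<open>vs\<close> of the vertices (a distinct list whose set is
  \<^term>\<open>pverts G\<close>), the vertex \<open>vs ! i\<close> having index \<open>i\<close>.
\<close>

abbreviation vertex_degree :: "'a pair_pre_digraph \<Rightarrow> 'a \<Rightarrow> nat" where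
  "vertex_degree G u \<equiv> out_degree (with_proj G) u"

definition randic_mat :: "'a pair_pre_digraph \<Rightarrow> 'a list \<Rightarrow> real mat" where
  "randic_mat G vs = mat (length vs) (length vs) (\<lambda>(i, j).
     if (vs ! i, vs ! j) \<in> parcs G
     then 1 / sqrt (real (vertex_degree G (vs ! i)) * real (vertex_degree G (vs ! j))) else 0)"

text \<open>Only meaningful for graphs without isolated vertices.\<close>

definition normalized_laplacian_mat :: "'a pair_pre_digraph \<Rightarrow> 'a list \<Rightarrow> real mat" where
  "normalized_laplacian_mat G vs = 1\<^sub>m (length vs) - randic_mat G vs"

text \<open>
  The real eigenvalues with algebraic multiplicity. The matrices above are symmetric, so these are
  all \<open>n\<close> eigenvalues.
\<close>

definition eigenvalues_mset :: "real mat \<Rightarrow> real multiset" where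
  "eigenvalues_mset A = proots (char_poly A)"

lemma set_mset_eigenvalues_mset:
  assumes A: "A \<in> carrier_mat n n"
  shows "set_mset (eigenvalues_mset A) = {k. eigenvalue A k}"
proof -
  have "char_poly A \<noteq> 0"
    using degree_monic_char_poly[OF A] by auto
  then show ?thesis
    by (simp add: eigenvalues_mset_def eigenvalue_root_char_poly[OF A])
qed

definition randic_energy :: "'a pair_pre_digraph \<Rightarrow> 'a list \<Rightarrow> real" where
  "randic_energy G vs = (\<Sum>x \<in># eigenvalues_mset (randic_mat G vs). \<bar>x\<bar>)"

definition normalized_laplacian_energy :: "'a pair_pre_digraph \<Rightarrow> 'a list \<Rightarrow> real" where
  "normalized_laplacian_energy G vs =
     (\<Sum>\<mu> \<in># eigenvalues_mset (normalized_laplacian_mat G vs). \<bar>\<mu> - 1\<bar>)"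

definition star :: "nat \<Rightarrow> nat pair_pre_digraph" where
  "star p = \<lparr> pverts = {0..p}, parcs = {0} \<times> {1..p} \<union> {1..p} \<times> {0} \<rparr>"

text \<open>
  The edge between the center \<open>0\<close> and the leaf \<open>i\<close> is subdivided by the new vertex \<open>p + i\<close>.
\<close>

definition sun :: "nat \<Rightarrow> nat pair_pre_digraph" where
  "sun p = fold (\<lambda>i G. subdivide G (0, i) (p + i)) [1..<Suc p] (star p)"

lemma sun_fold:
  assumes "k \<le> p"
  shows "fold (\<lambda>i G. subdivide G (0, i) (p + i)) [1..<Suc k] (star p) =
    \<lparr> pverts = {0..p + k},
      parcs = {0} \<times> {k<..p} \<union> {k<..p} \<times> {0}
        \<union> (\<Union>i\<in>{1..k}. {(0, p + i), (p + i, 0), (p + i, i), (i, p + i)}) \<rparr>"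
  using assms
proof (induction k)
  case 0
  then show ?case by (auto simp: star_def)
next
  case (Suc k)
  have IH: "fold (\<lambda>i G. subdivide G (0, i) (p + i)) [1..<Suc k] (star p) =
    \<lparr> pverts = {0..p + k},
      parcs = {0} \<times> {k<..p} \<union> {k<..p} \<times> {0}
        \<union> (\<Union>i\<in>{1..k}. {(0, p + i), (p + i, 0), (p + i, i), (i, p + i)}) \<rparr>"
    using Suc by simp
  have ivl: "{1..Suc k} = insert (Suc k) {1..k}" "{k<..p} = insert (Suc k) {Suc k<..p}"
    using Suc.prems by auto
  have "fold (\<lambda>i G. subdivide G (0, i) (p + i)) [1..<Suc (Suc k)] (star p)
      = subdivide (fold (\<lambda>i G. subdivide G (0, i) (p + i)) [1..<Suc k] (star p)) (0, Suc k) (p + Suc k)"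
    by simp
  also have "\<dots> = \<lparr> pverts = {0..p + Suc k},
      parcs = {0} \<times> {Suc k<..p} \<union> {Suc k<..p} \<times> {0}
        \<union> (\<Union>i\<in>{1..Suc k}. {(0, p + i), (p + i, 0), (p + i, i), (i, p + i)}) \<rparr>"
  proof -
    let ?C = "\<Union>i\<in>{1..k}. {(0, p + i), (p + i, 0), (p + i, i), (i, p + i)}"
    have new: "({0} \<times> {k<..p} \<union> {k<..p} \<times> {0} \<union> ?C) - {(0, Suc k), (Suc k, 0)}
        = {0} \<times> {Suc k<..p} \<union> {Suc k<..p} \<times> {0} \<union> ?C"
    proof -
      have "?C \<inter> {(0, Suc k), (Suc k, 0)} = {}"
        using Suc.prems by auto
      moreover have "({0} \<times> {k<..p} \<union> {k<..p} \<times> {0}) - {(0, Suc k), (Suc k, 0)}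
          = {0} \<times> {Suc k<..p} \<union> {Suc k<..p} \<times> {0}"
        unfolding ivl(2) by auto
      ultimately show ?thesis by (simp only: Un_Diff[of _ ?C] Diff_triv)
    qed
    have pv: "{0..p + k} \<union> {p + Suc k} = {0..p + Suc k}"
      by auto
    show ?thesis
      unfolding IH
      unfolding subdivide.simps pair_pre_digraph.simps new pv ivl(1) UN_insert
      by (simp only: Un_assoc Un_commute[of ?C])
  qed
  finally show ?case .
qed

lemma sun_eq:
  "sun p = \<lparr> pverts = {0..2 * p},
     parcs = (\<Union>i\<in>{1..p}. {(0, p + i), (p + i, 0), (p + i, i), (i, p + i)}) \<rparr>"
  using sun_fold[of p p] by (simp add: sun_def mult_2)

lemma pair_graph_sun: "pair_graph (sun p)"
proof
  show "symmetric (with_proj (sun p))"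
    by (force simp: symmetric_def sun_eq sym_def)
qed (auto simp: sun_eq)

definition is_sun :: "nat \<Rightarrow> 'a pair_pre_digraph \<Rightarrow> bool" where
  "is_sun p G \<longleftrightarrow> pair_graph G \<and> digraph_iso (with_proj G) (with_proj (sun p))"

end

theory Submission imports Defs
begin

text \<open>
  The whole spectrum is computed: the Randic matrix \<open>R\<close> of the \<open>p\<close>-sun has the eigenvalues
  \<open>0\<close>, \<open>1\<close>, \<open>- 1\<close> once each and \<open>sqrt 2 / 2\<close>, \<open>- sqrt 2 / 2\<close> with multiplicity \<open>p - 1\<close> each.
  The absolute values add up to the claimed energy. The normalized Laplacian \<open>1 - R\<close> has the
  eigenvalues \<open>1 - r\<close> for the eigenvalues \<open>r\<close> of \<open>R\<close> (\<open>char_poly_one_minus\<close>), and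
  \<open>\<bar>(1 - r) - 1\<bar> = \<bar>r\<bar>\<close>, so that both energies agree term by term.

  The characteristic polynomial comes from Gaussian elimination. In a tree, eliminating the vertices
  from the periphery inwards produces no new nonzero entries outside the tree. The sun has an order
  that is nearly as good and agrees with the numbering of its vertices: first the subdividing
  vertices, then the leaves of the star, then the center. Eliminating a subdividing vertex couples
  only its leaf to the center, so after it the leaves are still mutually uncoupled. Scaling the
  columns avoids all divisions; the elimination is then an identity \<open>M * L = U\<close> of triangular matrices
  over any commutative ring (\<open>det_sun_mat\<close>). It is applied over the ring of polynomials, where the
  factor \<open>det L\<close> can be cancelled (\<open>char_poly_sun_mat\<close>).

  An isomorphism preserves arcs and degrees, so for an arbitrary enumeration of the vertices of an
  isomorphic graph the rows and columns are merely permuted simultaneously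
  (\<open>char_poly_randic_mat_is_sun\<close>).
\<close>

section \<open>Characteristic polynomials under permutation and reflection\<close>

text \<open>The sign of the permutation enters once for the rows and once for the columns.\<close>

lemma det_permute_rows_cols:
  fixes A :: "'a :: comm_ring_1 mat"
  assumes A: "A \<in> carrier_mat n n" and \<pi>: "\<pi> permutes {0..<n}"
  shows "det (mat n n (\<lambda>(i, j). A $$ (\<pi> i, \<pi> j))) = det A"
proof -
  have lt: "\<pi> i < n" if "i < n" for i
    using permutes_in_image[OF \<pi>, of i] that by simp
  define B where "B = mat n n (\<lambda>(i, j). A $$ (\<pi> i, j))"
  have B: "B \<in> carrier_mat n n" by (simp add: B_def)
  have "mat n n (\<lambda>(i, j). A $$ (\<pi> i, \<pi> j))
      = transpose_mat (mat n n (\<lambda>(i, j). transpose_mat B $$ (\<pi> i, j)))"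
    by (rule eq_matI) (auto simp: B_def lt)
  then have "det (mat n n (\<lambda>(i, j). A $$ (\<pi> i, \<pi> j)))
      = det (mat n n (\<lambda>(i, j). transpose_mat B $$ (\<pi> i, j)))"
    by (simp add: det_transpose[of _ n])
  also have "\<dots> = signof \<pi> * det (transpose_mat B)"
    by (rule det_permute_rows[OF _ \<pi>]) (simp add: B)
  also have "det (transpose_mat B) = signof \<pi> * det A"
    unfolding det_transpose[OF B] unfolding B_def by (rule det_permute_rows[OF A \<pi>])
  finally show ?thesis
    by (cases "sign \<pi> = 1") (auto simp: sign_def)
qed

lemma char_poly_permute:
  fixes A :: "'a :: comm_ring_1 mat"
  assumes A: "A \<in> carrier_mat n n" and \<pi>: "\<pi> permutes {0..<n}"
  shows "char_poly (mat n n (\<lambda>(i, j). A $$ (\<pi> i, \<pi> j))) = char_poly A"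
proof -
  have lt: "\<pi> i < n" if "i < n" for i
    using permutes_in_image[OF \<pi>, of i] that by simp
  have "char_poly_matrix (mat n n (\<lambda>(i, j). A $$ (\<pi> i, \<pi> j)))
      = mat n n (\<lambda>(i, j). char_poly_matrix A $$ (\<pi> i, \<pi> j))"
    using A inj_eq[OF permutes_inj[OF \<pi>]]
    by (intro eq_matI) (auto simp: char_poly_matrix_def lt)
  then show ?thesis
    unfolding char_poly_def using A \<pi> by (simp add: det_permute_rows_cols)
qed

lemma prod_linear_neq_0: "(\<Prod>r\<in>#S. [:- r, 1:]) \<noteq> (0 :: 'a :: idom poly)"
  by (auto simp: prod_mset_zero_iff)

lemma proots_prod_linear: "proots (\<Prod>r\<in>#S. [:- r, 1:]) = (S :: 'a :: idom multiset)"
proof (induction S)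
  case (add x S)
  have "proots ([:- x, 1:] * (\<Prod>r\<in>#S. [:- r, 1:])) = {#x#} + proots (\<Prod>r\<in>#S. [:- r, 1:])"
    by (subst proots_mult) (use prod_linear_neq_0 in auto)
  then show ?case using add by simp
qed simp

lemma degree_prod_linear: "degree (\<Prod>r\<in>#S. [:- r, 1 :: 'a :: idom:]) = size S"
proof (induction S)
  case (add x S)
  have "degree ([:- x, 1:] * (\<Prod>r\<in>#S. [:- r, 1:])) = 1 + degree (\<Prod>r\<in>#S. [:- r, 1:])"
    by (subst degree_mult_eq) (use prod_linear_neq_0 in auto)
  then show ?case using add by simp
qed simp

text \<open>
  Evaluation at \<open>x\<close> turns \<open>x - (1 - A)\<close> into \<open>- ((1 - x) - A)\<close>, a value of the characteristic
  polynomial of \<open>A\<close> up to the sign \<open>(- 1) ^ n\<close>. That sign is absorbed by the \<open>n\<close> linear factors,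
  so \<open>A\<close> has to split completely.
\<close>

lemma char_poly_one_minus:
  fixes A :: "'a :: field_char_0 mat"
  assumes A: "A \<in> carrier_mat n n" and S: "char_poly A = (\<Prod>r\<in>#S. [:- r, 1:])"
  shows "char_poly (1\<^sub>m n - A) = (\<Prod>r\<in>#S. [:- (1 - r), 1:])"
proof -
  have size: "size S = n"
    using degree_monic_char_poly[OF A] S degree_prod_linear[of S] by simp
  have "poly (char_poly (1\<^sub>m n - A)) x = poly (\<Prod>r\<in>#S. [:- (1 - r), 1:]) x" for x
  proof -
    have "- char_matrix (1\<^sub>m n - A) x = (- 1) \<cdot>\<^sub>m (- char_matrix A (1 - x))"
      using A by (intro eq_matI) (auto simp: char_matrix_def)
    moreover have "dim_col (char_matrix A (1 - x)) = n"
      using A by (simp add: char_matrix_def)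
    moreover have "1\<^sub>m n - A \<in> carrier_mat n n"
      by (rule minus_carrier_mat[OF A])
    ultimately have "poly (char_poly (1\<^sub>m n - A)) x = (- 1) ^ n * poly (char_poly A) (1 - x)"
      using A by (simp add: char_poly_matrix[of _ n])
    also have "\<dots> = (- 1) ^ size S * poly (\<Prod>r\<in>#S. [:- r, 1:]) (1 - x)"
      by (simp only: size S)
    also have "\<dots> = poly (\<Prod>r\<in>#S. [:- (1 - r), 1:]) x"
      by (induction S) (simp_all add: algebra_simps)
    finally show ?thesis .
  qed
  then show ?thesis
    by (simp add: poly_eq_poly_eq_iff[symmetric] fun_eq_iff)
qed

section \<open>The spectrum of the sun\<close>

text \<open>
  The diagonal \<open>x\<close> is a parameter, and the ring is arbitrary, because the same pattern describes the
  Randic matrix itself (\<open>x = 0\<close>) and the matrix of polynomials whose determinant is its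
  characteristic polynomial. Here \<open>a\<close> belongs to the edges between \<open>i\<close> and \<open>p + i\<close>,
  and \<open>b\<close> to those between the center \<open>0\<close> and \<open>p + i\<close>.
\<close>

definition sun_mat :: "nat \<Rightarrow> 'a :: comm_ring_1 \<Rightarrow> 'a \<Rightarrow> 'a \<Rightarrow> 'a mat" where
  "sun_mat p x a b = mat (2 * p + 1) (2 * p + 1) (\<lambda>(u, v).
     if u = v then x
     else if u = 0 \<and> p < v \<or> v = 0 \<and> p < u then b
     else if 0 < u \<and> v = p + u \<or> 0 < v \<and> u = p + v then a
     else 0)"

lemma sun_vertex_cases:
  fixes u p :: nat
  assumes "u < 2 * p + 1"
  obtains (center) "u = 0" | (leaf) "u \<in> {1..p}" | (mid) i where "i \<in> {1..p}" "u = p + i"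
proof -
  consider "u = 0" | "u \<in> {1..p}" | "u - p \<in> {1..p}" "u = p + (u - p)"
    using assms by fastforce
  then show thesis using that by metis
qed

lemma prod_sun_vertices:
  fixes f :: "nat \<Rightarrow> 'a :: comm_monoid_mult"
  shows "(\<Prod>u = 0..<2 * p + 1. f u) = f 0 * (\<Prod>i = 1..p. f i) * (\<Prod>i = 1..p. f (p + i))"
proof -
  have "{0..<2 * p + 1} = {0} \<union> {1..p} \<union> (\<lambda>i. p + i) ` {1..p}"
    by (auto simp: image_iff elim!: sun_vertex_cases) 
  moreover have "inj_on (\<lambda>i. p + i) {1..p}" by simp
  moreover have "({0} \<union> {1..p}) \<inter> (\<lambda>i. p + i) ` {1..p} = {}" by auto
  ultimately show ?thesis
    by (simp add: prod.union_disjoint prod.reindex mult.assoc del: image_add_atLeastAtMost)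
qed

lemma sum_sun_vertices:
  fixes f :: "nat \<Rightarrow> 'a :: comm_monoid_add"
  shows "(\<Sum>u = 0..<2 * p + 1. f u) = f 0 + (\<Sum>i = 1..p. f i) + (\<Sum>i = 1..p. f (p + i))"
proof -
  have "{0..<2 * p + 1} = {0} \<union> {1..p} \<union> (\<lambda>i. p + i) ` {1..p}"
    by (auto simp: image_iff elim!: sun_vertex_cases)
  moreover have "inj_on (\<lambda>i. p + i) {1..p}" by simp
  moreover have "({0} \<union> {1..p}) \<inter> (\<lambda>i. p + i) ` {1..p} = {}" by auto
  ultimately show ?thesis
    by (simp add: sum.union_disjoint sum.reindex add.assoc del: image_add_atLeastAtMost)
qed

lemma sum_sun_mat:
  fixes h :: "nat \<Rightarrow> 'a :: comm_ring_1" and x a b :: 'a and p :: nat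
  defines "M \<equiv> sun_mat p x a b"
  shows sum_sun_mat_center: "(\<Sum>v = 0..<2 * p + 1. M $$ (0, v) * h v) = x * h 0 + b * (\<Sum>i = 1..p. h (p + i))"
    and sum_sun_mat_leaf: "i \<in> {1..p} \<Longrightarrow>
      (\<Sum>v = 0..<2 * p + 1. M $$ (i, v) * h v) = x * h i + a * h (p + i)"
    and sum_sun_mat_mid: "i \<in> {1..p} \<Longrightarrow>
      (\<Sum>v = 0..<2 * p + 1. M $$ (p + i, v) * h v) = b * h 0 + a * h i + x * h (p + i)"
proof -
  have "(\<Sum>i = 1..p. M $$ (0, i) * h i) = 0"
    by (rule sum.neutral) (auto simp: M_def sun_mat_def)
  moreover have "(\<Sum>i = 1..p. M $$ (0, p + i) * h (p + i)) = b * (\<Sum>i = 1..p. h (p + i))"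
    unfolding sum_distrib_left by (rule sum.cong) (auto simp: M_def sun_mat_def)
  ultimately show "(\<Sum>v = 0..<2 * p + 1. M $$ (0, v) * h v) = x * h 0 + b * (\<Sum>i = 1..p. h (p + i))"
    unfolding sum_sun_vertices by (simp add: M_def sun_mat_def)
next
  assume i: "i \<in> {1..p}"
  have "(\<Sum>j = 1..p. M $$ (i, j) * h j) = (\<Sum>j = 1..p. if j = i then x * h j else 0)"
    using i by (intro sum.cong) (auto simp: M_def sun_mat_def)
  moreover have "(\<Sum>j = 1..p. M $$ (i, p + j) * h (p + j))
      = (\<Sum>j = 1..p. if j = i then a * h (p + j) else 0)"
    using i by (intro sum.cong) (auto simp: M_def sun_mat_def)
  moreover have "M $$ (i, 0) = 0"
    using i by (auto simp: M_def sun_mat_def)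
  ultimately show "(\<Sum>v = 0..<2 * p + 1. M $$ (i, v) * h v) = x * h i + a * h (p + i)"
    unfolding sum_sun_vertices using i by simp
next
  assume i: "i \<in> {1..p}"
  have "(\<Sum>j = 1..p. M $$ (p + i, j) * h j) = (\<Sum>j = 1..p. if j = i then a * h j else 0)"
    using i by (intro sum.cong) (auto simp: M_def sun_mat_def)
  moreover have "(\<Sum>j = 1..p. M $$ (p + i, p + j) * h (p + j))
      = (\<Sum>j = 1..p. if j = i then x * h (p + j) else 0)"
    using i by (intro sum.cong) (auto simp: M_def sun_mat_def)
  moreover have "M $$ (p + i, 0) = b"
    using i by (auto simp: M_def sun_mat_def)
  ultimately show "(\<Sum>v = 0..<2 * p + 1. M $$ (p + i, v) * h v) = b * h 0 + a * h i + x * h (p + i)"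
    unfolding sum_sun_vertices using i by simp
qed

text \<open>
  The columns of \<open>L\<close> solve the linear equations that make \<open>M * L\<close> upper triangular: the column of a
  leaf \<open>i\<close> combines \<open>i\<close> with \<open>p + i\<close> so that row \<open>p + i\<close> vanishes, and the column of the center combines
  all vertices so that only row \<open>0\<close> survives. Each column is scaled by the pivots it would be
  divided by, which is why \<open>det L = (x\<^sup>2 - a\<^sup>2) * x ^ p\<close> remains as a factor; it
  cannot be cancelled in a ring with zero divisors.
\<close>

lemma det_sun_mat:
  fixes x a b :: "'a :: comm_ring_1"
  shows "det (sun_mat p x a b) * ((x\<^sup>2 - a\<^sup>2) * x ^ p)
    = x * (x\<^sup>2 - a\<^sup>2 - of_nat p * b\<^sup>2) * (x\<^sup>2 - a\<^sup>2) ^ p * x ^ p"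
proof -
  define n where "n = 2 * p + 1"
  define l where "l u v = (if v = 0 then (if u = 0 then x\<^sup>2 - a\<^sup>2 else if u \<le> p then a * b else - b * x)
    else if v \<le> p then (if u = v then x else if u = p + v then - a else 0)
    else if u = v then 1 else 0)" for u v
  define M where "M = sun_mat p x a b"
  define L where "L = mat n n (\<lambda>(u, v). l u v)"
  have M: "M \<in> carrier_mat n n" and L: "L \<in> carrier_mat n n"
    by (simp_all add: M_def L_def sun_mat_def n_def)
  have entry: "(M * L) $$ (u, v) = (\<Sum>w = 0..<n. M $$ (u, w) * l w v)" if "u < n" "v < n" for u v
    using that M L by (auto simp: L_def scalar_prod_def intro!: sum.cong)
  have idx: "0 < n" "i < n" "p + i < n" if "i \<in> {1..p}" for i
    using that by (auto simp: n_def)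
  have row0: "(M * L) $$ (0, v) = x * l 0 v + b * (\<Sum>i = 1..p. l (p + i) v)" if "v < n" for v
    using that entry[of 0 v] sum_sun_mat_center[of p x a b "\<lambda>w. l w v"]
    by (simp only: M_def n_def)
  have row_leaf: "(M * L) $$ (i, v) = x * l i v + a * l (p + i) v" if "i \<in> {1..p}" "v < n" for i v
    using entry[OF idx(2)[OF that(1)] that(2)] sum_sun_mat_leaf[OF that(1), of x a b "\<lambda>w. l w v"]
    by (simp only: M_def n_def)
  have row_mid: "(M * L) $$ (p + i, v) = b * l 0 v + a * l i v + x * l (p + i) v"
    if "i \<in> {1..p}" "v < n" for i v
    using entry[OF idx(3)[OF that(1)] that(2)] sum_sun_mat_mid[OF that(1), of x a b "\<lambda>w. l w v"]
    by (simp only: M_def n_def)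
  have center: "(M * L) $$ (0, 0) = x * (x\<^sup>2 - a\<^sup>2 - of_nat p * b\<^sup>2)"
  proof -
    have "(\<Sum>i = 1..p. l (p + i) 0) = (\<Sum>i = 1..p. - b * x)"
      by (rule sum.cong) (auto simp: l_def)
    then show ?thesis
      by (simp add: row0 n_def l_def algebra_simps power2_eq_square)
  qed
  have leaf: "(M * L) $$ (i, i) = x\<^sup>2 - a\<^sup>2" if "i \<in> {1..p}" for i
    using that idx[OF that] by (simp add: row_leaf) (simp add: l_def power2_eq_square)
  have mid: "(M * L) $$ (p + i, p + i) = x" if "i \<in> {1..p}" for i
    using that idx[OF that] by (simp add: row_mid) (simp add: l_def)
  have "upper_triangular (M * L)"
  proof
    fix u v assume "v < u" "u < dim_row (M * L)"
    then have uv: "v < u" "u < n" using M by auto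
    from uv(2)[unfolded n_def] show "(M * L) $$ (u, v) = 0"
    proof (cases rule: sun_vertex_cases)
      case center
      then show ?thesis using uv by simp
    next
      case leaf
      then show ?thesis using uv by (simp add: row_leaf) (simp add: l_def algebra_simps)
    next
      case (mid i)
      then show ?thesis using uv
        by (simp add: row_mid) (auto simp: l_def algebra_simps power2_eq_square)
    qed
  qed
  then have "det (M * L) = prod_list (diag_mat (M * L))"
    by (rule det_upper_triangular) (rule mult_carrier_mat[OF M L])
  also have "\<dots> = (\<Prod>u = 0..<n. (M * L) $$ (u, u))"
    using M by (simp add: prod_list_diag_prod)
  also have "\<dots> = x * (x\<^sup>2 - a\<^sup>2 - of_nat p * b\<^sup>2) * (x\<^sup>2 - a\<^sup>2) ^ p * x ^ p"
  proof -
    have "(\<Prod>i = 1..p. (M * L) $$ (i, i)) = (\<Prod>i = 1..p. x\<^sup>2 - a\<^sup>2)"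
      by (rule prod.cong[OF refl leaf])
    moreover have "(\<Prod>i = 1..p. (M * L) $$ (p + i, p + i)) = (\<Prod>i = 1..p. x)"
      by (rule prod.cong[OF refl mid])
    ultimately show ?thesis
      unfolding n_def prod_sun_vertices center by (simp only: prod_constant card_atLeastAtMost) simp
  qed
  finally have "det (M * L) = \<dots>" .
  moreover have "det L = (x\<^sup>2 - a\<^sup>2) * x ^ p"
  proof -
    have "det L = prod_list (diag_mat L)"
      by (rule det_lower_triangular[OF _ L]) (auto simp: L_def l_def n_def)
    also have "\<dots> = (\<Prod>u = 0..<n. l u u)"
      by (auto simp: prod_list_diag_prod L_def intro!: prod.cong)
    also have "\<dots> = (x\<^sup>2 - a\<^sup>2) * (\<Prod>i = 1..p. x) * (\<Prod>i = 1..p. 1)"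
      unfolding n_def prod_sun_vertices by (intro arg_cong2[of _ _ _ _ "(*)"] prod.cong) (auto simp: l_def)
    finally show ?thesis by simp
  qed
  ultimately show ?thesis
    using det_mult[OF M L] by (simp add: M_def)
qed

lemma char_poly_sun_mat:
  fixes a b :: "'a :: idom"
  assumes "p \<ge> 1"
  shows "char_poly (sun_mat p 0 a b)
    = [:0, 1:] * [:- (a\<^sup>2 + of_nat p * b\<^sup>2), 0, 1:] * [:- a\<^sup>2, 0, 1:] ^ (p - 1)"
proof -
  define X :: "'a poly" where "X = [:0, 1:]"
  define Q :: "'a poly" where "Q = [:- a\<^sup>2, 0, 1:]"
  have "X \<noteq> 0" "Q \<noteq> 0"
    by (simp_all add: X_def Q_def)
  then have nz: "Q * X ^ p \<noteq> 0"
    by simp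
  have "char_poly_matrix (sun_mat p 0 a b) = sun_mat p X [:- a:] [:- b:]"
    by (rule eq_matI) (auto simp: char_poly_matrix_def sun_mat_def X_def)
  moreover have Q: "X\<^sup>2 - [:- a:]\<^sup>2 = Q"
    by (simp add: X_def Q_def power2_eq_square)
  moreover have "Q - of_nat p * [:- b:]\<^sup>2 = [:- (a\<^sup>2 + of_nat p * b\<^sup>2), 0, 1:]"
    by (simp add: Q_def power2_eq_square of_nat_poly)
  ultimately have "char_poly (sun_mat p 0 a b) * (Q * X ^ p)
      = X * [:- (a\<^sup>2 + of_nat p * b\<^sup>2), 0, 1:] * Q ^ p * X ^ p"
    using det_sun_mat[of p X "[:- a:]" "[:- b:]"] by (simp only: char_poly_def)
  also have "\<dots> = X * [:- (a\<^sup>2 + of_nat p * b\<^sup>2), 0, 1:] * Q ^ (p - 1) * (Q * X ^ p)"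
    using assms by (simp only: power_minus_mult[of p Q, symmetric] ac_simps)
  finally show ?thesis
    using mult_right_cancel[OF nz] by (simp only: X_def Q_def)
qed

lemma char_poly_randic_sun_mat:
  assumes "p \<ge> 1"
  shows "char_poly (sun_mat p 0 (1 / sqrt 2) (1 / sqrt (2 * real p)))
    = (\<Prod>r\<in>#{#0, 1, - 1#} + replicate_mset (p - 1) (sqrt 2 / 2)
        + replicate_mset (p - 1) (- (sqrt 2 / 2)). [:- r, 1:])"
proof -
  have "(1 / sqrt 2)\<^sup>2 + of_nat p * (1 / sqrt (2 * real p))\<^sup>2 = (1 :: real)"
    using assms by (simp add: power_divide)
  then have "char_poly (sun_mat p 0 (1 / sqrt 2) (1 / sqrt (2 * real p)))
      = [:0, 1:] * [:- 1, 0, 1:] * [:- (1 / 2), 0, 1:] ^ (p - 1)"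
    using char_poly_sun_mat[OF assms, of "1 / sqrt 2" "1 / sqrt (2 * real p)"]
    by (simp add: power_divide)
  moreover have "[:- 1, 0, 1:] = [:- 1, 1:] * [:1, 1 :: real:]"
    by simp
  moreover have "[:- (1 / 2), 0, 1:] = [:- (sqrt 2 / 2), 1:] * [:sqrt 2 / 2, 1 :: real:]"
    by simp
  ultimately show ?thesis
    by (simp add: power_mult_distrib mult.assoc del: mult_pCons_left mult_pCons_right)
qed

section \<open>The matrix of a graph isomorphic to the sun\<close>

text \<open>
  A digraph isomorphism maps arcs by a component of its own; since in a pair digraph an arc is
  determined by its end points, that component is forced to be the one induced on pairs.
\<close>

lemma parcs_iso_iff:
  assumes wf: "wf_digraph (with_proj G)"
    and \<phi>: "pre_digraph.digraph_isomorphism (with_proj G) \<phi>"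
    and H: "with_proj H = app_iso \<phi> (with_proj G)"
    and uv: "u \<in> pverts G" "v \<in> pverts G"
  shows "(iso_verts \<phi> u, iso_verts \<phi> v) \<in> parcs H \<longleftrightarrow> (u, v) \<in> parcs G"
proof -
  let ?f = "iso_verts \<phi>"
  have ends: "arcs_ends (with_proj G) = parcs G" "arcs_ends (with_proj H) = parcs H"
    by (simp_all add: arcs_ends_conv)
  have image: "parcs H = (\<lambda>(u, v). (?f u, ?f v)) ` parcs G"
    using wf_digraph.arcs_ends_app_iso_eq[OF wf \<phi>] by (simp only: ends H[symmetric])
  have inj: "inj_on ?f (pverts G)"
    using \<phi> by (simp add: pre_digraph.digraph_isomorphism_def)
  have "fst e \<in> pverts G \<and> snd e \<in> pverts G" if "e \<in> parcs G" for e
    using wf_digraph.tail_in_verts[OF wf, of e] wf_digraph.head_in_verts[OF wf, of e] that by simp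
  then show ?thesis
    using inj_on_eq_iff[OF inj] uv unfolding image by (auto simp: image_iff Bex_def)
qed

lemma vertex_degree_sun:
  shows "vertex_degree (sun p) 0 = p"
    and "i \<in> {1..p} \<Longrightarrow> vertex_degree (sun p) i = 1"
    and "i \<in> {1..p} \<Longrightarrow> vertex_degree (sun p) (p + i) = 2"
proof -
  have "out_arcs (with_proj (sun p)) 0 = (\<lambda>i. (0, p + i)) ` {1..p}"
    by (auto simp: out_arcs_def sun_eq)
  then show "vertex_degree (sun p) 0 = p"
    by (simp add: out_degree_def card_image inj_on_def)
next
  assume i: "i \<in> {1..p}"
  then have "out_arcs (with_proj (sun p)) i = {(i, p + i)}"
    by (auto simp: out_arcs_def sun_eq)
  then show "vertex_degree (sun p) i = 1"
    by (simp add: out_degree_def)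
  have "out_arcs (with_proj (sun p)) (p + i) = {(p + i, 0), (p + i, i)}"
    using i by (auto simp: out_arcs_def sun_eq)
  then show "vertex_degree (sun p) (p + i) = 2"
    using i by (simp add: out_degree_def)
qed

lemma randic_mat_sun:
  "randic_mat (sun p) [0..<2 * p + 1] = sun_mat p 0 (1 / sqrt 2) (1 / sqrt (2 * real p))"
proof -
  let ?d = "vertex_degree (sun p)" and ?S = "sun_mat p 0 (1 / sqrt 2) (1 / sqrt (2 * real p))"
  have arcs: "parcs (sun p) = (\<Union>i\<in>{1..p}. {(0, p + i), (p + i, 0), (p + i, i), (i, p + i)})"
    by (simp add: sun_eq)
  have mem: "(0, p + i) \<in> parcs (sun p)" "(p + i, 0) \<in> parcs (sun p)"
    "(0, i) \<notin> parcs (sun p)" "(i, 0) \<notin> parcs (sun p)"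
    "(i, j) \<notin> parcs (sun p)" "(p + i, p + j) \<notin> parcs (sun p)"
    "(i, p + j) \<in> parcs (sun p) \<longleftrightarrow> i = j" "(p + j, i) \<in> parcs (sun p) \<longleftrightarrow> i = j"
    if "i \<in> {1..p}" "j \<in> {1..p}" for i j
    using that unfolding arcs by auto
  have "(0, 0) \<notin> parcs (sun p)"
    unfolding arcs by auto
  note mem = this mem
  have entry: "(if (u, v) \<in> parcs (sun p) then 1 / sqrt (real (?d u) * real (?d v)) else 0)
      = ?S $$ (u, v)"
    if u: "u < 2 * p + 1" and v: "v < 2 * p + 1" for u v
    using u
  proof (cases rule: sun_vertex_cases)
    case center
    from v show ?thesis
      by (cases rule: sun_vertex_cases)
        (use center in \<open>auto simp: mem sun_mat_def vertex_degree_sun mult.commute\<close>)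
  next
    case leaf
    from v show ?thesis
      by (cases rule: sun_vertex_cases)
        (use leaf in \<open>auto simp: mem sun_mat_def vertex_degree_sun mult.commute\<close>)
  next
    case (mid i)
    from v show ?thesis
      by (cases rule: sun_vertex_cases)
        (use mid in \<open>auto simp: mem sun_mat_def vertex_degree_sun mult.commute\<close>)
  qed
  have dim: "dim_row ?S = 2 * p + 1" "dim_col ?S = 2 * p + 1"
    by (simp_all add: sun_mat_def)
  show ?thesis
  proof (rule eq_matI, unfold dim)
    fix u v assume uv: "u < 2 * p + 1" "v < 2 * p + 1"
    then have "randic_mat (sun p) [0..<2 * p + 1] $$ (u, v)
        = (if (u, v) \<in> parcs (sun p) then 1 / sqrt (real (?d u) * real (?d v)) else 0)"
      by (simp add: randic_mat_def del: upt_Suc)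
    then show "randic_mat (sun p) [0..<2 * p + 1] $$ (u, v) = ?S $$ (u, v)"
      using entry[OF uv] by (rule trans)
  qed (simp_all add: randic_mat_def)
qed

text \<open>
  The vertices of the sun are their own indices, so the images of \<open>vs\<close> under the isomorphism
  form a permutation of the indices.
\<close>

lemma char_poly_randic_mat_is_sun:
  assumes "is_sun p G" and "distinct vs" and "set vs = pverts G"
  shows "length vs = 2 * p + 1"
    and "char_poly (randic_mat G vs) = char_poly (randic_mat (sun p) [0..<2 * p + 1])"
proof -
  interpret pair_graph G using assms(1) by (simp add: is_sun_def)
  obtain \<phi> where \<phi>: "pre_digraph.digraph_isomorphism (with_proj G) \<phi>"
    and H: "with_proj (sun p) = app_iso \<phi> (with_proj G)"
    using assms(1) by (auto simp: is_sun_def digraph_iso_def)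
  let ?f = "iso_verts \<phi>" and ?n = "2 * p + 1"
  define ws where "ws = map ?f vs"
  have inj: "inj_on ?f (pverts G)"
    using \<phi> by (simp add: pre_digraph.digraph_isomorphism_def)
  have "?f ` pverts G = {0..2 * p}"
    using arg_cong[OF H, of verts] by (simp add: sun_eq)
  then have ws: "distinct ws" "set ws = {0..<?n}"
    using assms(2,3) inj by (auto simp: ws_def distinct_map)
  show len: "length vs = ?n"
    using distinct_card[OF ws(1)] ws(2) by (simp add: ws_def)
  \<comment> \<open>extended by the identity, as a permutation of an index set has to fix everything else\<close>
  define \<pi> where "\<pi> i = (if i < ?n then ws ! i else i)" for i
  have "bij_betw (\<lambda>i. ws ! i) {0..<?n} {0..<?n}"
    using bij_betw_nth[OF ws(1), of "{0..<?n}" "set ws"] ws(2) len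
    by (simp add: ws_def lessThan_atLeast0)
  then have "bij_betw \<pi> {0..<?n} {0..<?n}"
    by (rule bij_betw_cong[THEN iffD1, rotated]) (simp add: \<pi>_def)
  then have \<pi>: "\<pi> permutes {0..<?n}"
    by (rule bij_imp_permutes) (simp add: \<pi>_def)
  have lt: "\<pi> i < ?n" if "i < ?n" for i
    using permutes_in_image[OF \<pi>, of i] that by simp
  have wf: "wf_digraph (with_proj G)" ..
  have deg: "vertex_degree (sun p) (?f v) = vertex_degree G v" if "v \<in> pverts G" for v
    unfolding H using \<phi> that by (simp add: wf_digraph.out_degree_app_iso_eq[OF wf])
  have "randic_mat G vs = mat ?n ?n (\<lambda>(i, j). randic_mat (sun p) [0..<?n] $$ (\<pi> i, \<pi> j))"
  proof (rule eq_matI)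
    fix i j
    assume "i < dim_row (mat ?n ?n (\<lambda>(i, j). randic_mat (sun p) [0..<?n] $$ (\<pi> i, \<pi> j)))"
      and "j < dim_col (mat ?n ?n (\<lambda>(i, j). randic_mat (sun p) [0..<?n] $$ (\<pi> i, \<pi> j)))"
    then have ij: "i < ?n" "j < ?n" by auto
    then have V: "vs ! i \<in> pverts G" "vs ! j \<in> pverts G"
      using len assms(3) nth_mem[of _ vs] by (metis, metis)
    have p: "\<pi> i = ?f (vs ! i)" "\<pi> j = ?f (vs ! j)"
      using ij len by (auto simp: \<pi>_def ws_def)
    have "randic_mat (sun p) [0..<?n] $$ (\<pi> i, \<pi> j) = randic_mat G vs $$ (i, j)"
      using lt[OF ij(1)] lt[OF ij(2)] ij len
      by (simp add: randic_mat_def parcs_iso_iff[OF wf \<phi> H V] deg V p del: upt_Suc)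
    then show "randic_mat G vs $$ (i, j)
        = mat ?n ?n (\<lambda>(i, j). randic_mat (sun p) [0..<?n] $$ (\<pi> i, \<pi> j)) $$ (i, j)"
      using ij by simp
  qed (simp_all add: randic_mat_def len)
  then show "char_poly (randic_mat G vs) = char_poly (randic_mat (sun p) [0..<?n])"
    using \<pi> by (simp add: char_poly_permute randic_mat_def del: upt_Suc)
qed

section \<open>The energies\<close>

theorem mainTheorem7:
  fixes p n :: nat and G :: "'a pair_pre_digraph" and vs :: "'a list"
  assumes "p \<ge> 1"
    and "is_sun p G"
    and "distinct vs" and "set vs = pverts G"
    and "n = card (pverts G)"
  shows "n = 2 * p + 1
    \<and> randic_energy G vs = normalized_laplacian_energy G vs
    \<and> normalized_laplacian_energy G vs = 2 * (real p - 1) * (sqrt 2 / 2) + 2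
    \<and> 2 * (real p - 1) * (sqrt 2 / 2) + 2 = (real n - 3) * (sqrt 2 / 2) + 2"
proof -
  define S where "S = {#0, 1, - 1 :: real#} + replicate_mset (p - 1) (sqrt 2 / 2)
        + replicate_mset (p - 1) (- (sqrt 2 / 2))"
  note len = char_poly_randic_mat_is_sun(1)[OF assms(2-4)]
  have R: "randic_mat G vs \<in> carrier_mat (length vs) (length vs)"
    by (simp add: randic_mat_def)
  have char: "char_poly (randic_mat G vs) = (\<Prod>r\<in>#S. [:- r, 1:])"
    using char_poly_randic_mat_is_sun(2)[OF assms(2-4)] char_poly_randic_sun_mat[OF assms(1)]
    by (simp only: randic_mat_sun S_def)
  have randic: "eigenvalues_mset (randic_mat G vs) = S"
    by (simp only: eigenvalues_mset_def char proots_prod_linear)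
  have "char_poly (normalized_laplacian_mat G vs) = (\<Prod>\<mu>\<in>#image_mset (\<lambda>r. 1 - r) S. [:- \<mu>, 1:])"
    using char_poly_one_minus[OF R char]
    by (simp only: normalized_laplacian_mat_def multiset.map_comp o_def)
  then have laplacian: "eigenvalues_mset (normalized_laplacian_mat G vs) = image_mset (\<lambda>r. 1 - r) S"
    by (simp only: eigenvalues_mset_def proots_prod_linear)
  have "(\<Sum>r\<in>#S. \<bar>r\<bar>) = 2 * (real p - 1) * (sqrt 2 / 2) + 2"
    using assms(1) by (simp add: S_def of_nat_diff)
  moreover have "randic_energy G vs = (\<Sum>r\<in>#S. \<bar>r\<bar>)"
    by (simp only: randic_energy_def randic)
  moreover have "normalized_laplacian_energy G vs = (\<Sum>r\<in>#S. \<bar>r\<bar>)"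
    by (simp add: normalized_laplacian_energy_def laplacian multiset.map_comp o_def)
  moreover have "n = 2 * p + 1"
    using len distinct_card[OF assms(3)] assms(4,5) by simp
  ultimately show ?thesis by simp
qed

end
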